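(* Let $f:[0,1]\to[0,1]$ be given by $f(\Delta^{3}_{\alpha_1\alpha_2\ldots\alpha_n\ldots})=\Delta^{3}_{\varphi(\alpha_1)\varphi(\alpha_2)\ldots\varphi(\alpha_n)\ldots}$ with $\varphi(i)=\frac{-3i^2+7i}{2}$, $i\in\{0,1,2\}$. For $(ij)\in\{01,02,12\}$ let $f_{ij}:[0,1]\to[0,1]$ be given by $f_{ij}(\Delta^{3}_{\alpha_1\alpha_2\ldots\alpha_n\ldots})=\Delta^{3}_{\varphi_{ij}(\alpha_1)\varphi_{ij}(\alpha_2)\ldots\varphi_{ij}(\alpha_n)\ldots}$, where for $a\in\{0,1,2\}$ $$\varphi_{01}(a)=\frac{a^2-a}{2},\qquad \varphi_{12}(a)=\frac{a^2-3a+2}{2},\qquad \varphi_{02}(a)=-a^2+2a .$$ Then for every $x\in[0,1]$: (1) $f(x)=2x-3f_{01}(x)$; (2) $f(x)=\frac{3}{2}-x-3f_{12}(x)$; (3) $f(x)=\frac{x}{2}+\frac{3}{2}f_{02}(x)$.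
   Context: For digits $\alpha_n\in\{0,1,2\}$, $\Delta^{3}_{\alpha_1\alpha_2\ldots\alpha_n\ldots}$ denotes $\sum_{n=1}^{\infty}\alpha_n 3^{-n}$. Every $x\in[0,1]$ is written using its ternary representation that does not end in an infinite string of 2's, except that $1$ is written as $\Delta^{3}_{222\ldots}$; thus each $x$ has exactly one admissible digit sequence, and it is this sequence that is used in the definitions of $f$ and $f_{ij}$. The digit map $\varphi$ satisfies $\varphi(0)=0,\ \varphi(1)=2,\ \varphi(2)=1$. For pairwise distinct digits $i,j,k$, $\varphi_{ij}(i)=\varphi_{ij}(j)=0$ and $\varphi_{ij}(k)=1$. *)

theory Defs
  imports Complex_Main
begin

text \<open>Digits are integers, and sequences are indexed from 0: the entry \<open>\<alpha> n\<close> is the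
  \<open>(n+1)\<close>-st ternary digit.\<close>

definition ternary_value :: "(nat \<Rightarrow> int) \<Rightarrow> real"  (\<open>\<Delta>\<^sub>3\<close>)
  where "\<Delta>\<^sub>3 \<alpha> = (\<Sum>n. real_of_int (\<alpha> n) / 3 ^ Suc n)"

definition admissible_ternary :: "real \<Rightarrow> (nat \<Rightarrow> int) \<Rightarrow> bool"
  where "admissible_ternary x \<alpha> \<longleftrightarrow>
    (\<forall>n. \<alpha> n \<in> {0, 1, 2}) \<and> \<Delta>\<^sub>3 \<alpha> = x \<and>
    (if x = 1 then \<alpha> = (\<lambda>_. 2) else \<not> (\<exists>N. \<forall>n\<ge>N. \<alpha> n = 2))"

text \<open>Meaningful only for \<open>0 \<le> x \<le> 1\<close>, where exactly one admissible sequence exists.\<close>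

definition ternary_digits :: "real \<Rightarrow> nat \<Rightarrow> int"
  where "ternary_digits x = (THE \<alpha>. admissible_ternary x \<alpha>)"

definition digitwise :: "(int \<Rightarrow> int) \<Rightarrow> real \<Rightarrow> real"
  where "digitwise \<psi> x = \<Delta>\<^sub>3 (\<lambda>n. \<psi> (ternary_digits x n))"

text \<open>On the digits 0, 1, 2 the numerators below are even, so \<open>div\<close> is exact division.\<close>

definition \<phi> :: "int \<Rightarrow> int"
  where "\<phi> i = (- 3 * i\<^sup>2 + 7 * i) div 2"

definition \<phi>01 :: "int \<Rightarrow> int"
  where "\<phi>01 a = (a\<^sup>2 - a) div 2"

definition \<phi>12 :: "int \<Rightarrow> int"
  where "\<phi>12 a = (a\<^sup>2 - 3 * a + 2) div 2"

definition \<phi>02 :: "int \<Rightarrow> int"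
  where "\<phi>02 a = - a\<^sup>2 + 2 * a"

lemma \<phi>_digit [simp]: "\<phi> 0 = 0" "\<phi> 1 = 2" "\<phi> 2 = 1"
  by (simp_all add: \<phi>_def)

lemma \<phi>01_digit [simp]: "\<phi>01 0 = 0" "\<phi>01 1 = 0" "\<phi>01 2 = 1"
  by (simp_all add: \<phi>01_def)

lemma \<phi>12_digit [simp]: "\<phi>12 0 = 1" "\<phi>12 1 = 0" "\<phi>12 2 = 0"
  by (simp_all add: \<phi>12_def)

lemma \<phi>02_digit [simp]: "\<phi>02 0 = 0" "\<phi>02 1 = 1" "\<phi>02 2 = 0"
  by (simp_all add: \<phi>02_def)

definition f :: "real \<Rightarrow> real"
  where "f = digitwise \<phi>"

definition f01 :: "real \<Rightarrow> real"
  where "f01 = digitwise \<phi>01"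

definition f12 :: "real \<Rightarrow> real"
  where "f12 = digitwise \<phi>12"

definition f02 :: "real \<Rightarrow> real"
  where "f02 = digitwise \<phi>02"

end

theory Submission
  imports Defs
begin

text \<open>Each identity is linear in the digit functions and holds digit by digit: on the digits
  \<open>0, 1, 2\<close> one has \<open>\<phi> a = 2a - 3 \<phi>01 a = 3 - a - 3 \<phi>12 a = (a + 3 \<phi>02 a)/2\<close>,
  and the constant digit \<open>3\<close> has value \<open>3/2\<close>. Summing requires that the digit sequence
  chosen for \<open>x\<close> has value \<open>x\<close>, i.e. that \<open>x\<close> has exactly one admissible sequence. It exists
  because the remainders \<open>frac (3 ^ n * x) / 3 ^ n\<close> telescope; it is unique because a tail that is
  not all \<open>2\<close> has value below \<open>1\<close>, so that the leading digit is a floor.\<close>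

lemma ternary_one_sums: "(\<lambda>n. 1 / 3 ^ Suc n) sums (1 / 2 :: real)"
  using sums_mult[OF geometric_sums[of "1 / 3 :: real"], of "1 / 3"]
  by (simp add: power_one_over field_simps)

lemma ternary_sums:
  assumes "\<And>n. \<alpha> n \<in> {0, 1, 2}"
  shows "(\<lambda>n. real_of_int (\<alpha> n) / 3 ^ Suc n) sums \<Delta>\<^sub>3 \<alpha>"
  unfolding ternary_value_def
proof (rule summable_sums, rule summable_comparison_test')
  show "summable (\<lambda>n. 2 * (1 / 3 ^ Suc n) :: real)"
    using ternary_one_sums by (intro summable_mult) (rule sums_summable)
  show "norm (real_of_int (\<alpha> n) / 3 ^ Suc n) \<le> 2 * (1 / 3 ^ Suc n)" for n
    using assms[of n] by (auto simp: divide_simps)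
qed

lemma ternary_value_const_2: "\<Delta>\<^sub>3 (\<lambda>_. 2) = 1"
  using sums_mult[OF ternary_one_sums, of 2] ternary_sums[of "\<lambda>_. 2"]
  by (auto dest: sums_unique2)

lemma ternary_value_nonneg:
  assumes "\<And>n. \<alpha> n \<in> {0, 1, 2}"
  shows "0 \<le> \<Delta>\<^sub>3 \<alpha>"
proof -
  have "0 \<le> real_of_int (\<alpha> n) / 3 ^ Suc n" for n
    using assms[of n] by auto
  then show ?thesis
    unfolding ternary_value_def
    by (intro suminf_nonneg sums_summable[OF ternary_sums[OF assms]])
qed

text \<open>The complementary digits \<open>2 - \<alpha> n\<close> have value
  \<open>1 - \<Delta>\<^sub>3 \<alpha>\<close>; they are nonnegative, and the one at
  \<open>k\<close> is positive.\<close>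

lemma ternary_value_less_1:
  assumes digits: "\<And>n. \<alpha> n \<in> {0, 1, 2}" and "\<alpha> k \<noteq> 2"
  shows "\<Delta>\<^sub>3 \<alpha> < 1"
proof -
  have "(\<lambda>n. 2 * (1 / 3 ^ Suc n) - real_of_int (\<alpha> n) / 3 ^ Suc n) sums (2 * (1 / 2) - \<Delta>\<^sub>3 \<alpha>)"
    by (intro sums_diff sums_mult ternary_one_sums ternary_sums digits)
  then have s: "(\<lambda>n. real_of_int (2 - \<alpha> n) / 3 ^ Suc n) sums (1 - \<Delta>\<^sub>3 \<alpha>)"
    by (simp add: diff_divide_distrib)
  have nonneg: "0 \<le> real_of_int (2 - \<alpha> n) / 3 ^ Suc n" for n
    using digits[of n] by auto
  have pos: "0 < real_of_int (2 - \<alpha> k) / 3 ^ Suc k"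
    using digits[of k] assms(2) by auto
  have "0 < (\<Sum>n. real_of_int (2 - \<alpha> n) / 3 ^ Suc n)"
    using suminf_pos2[OF sums_summable[OF s] nonneg pos] .
  then show ?thesis
    using sums_unique[OF s] by simp
qed

text \<open>Multiplying by 3 moves the ternary point one place. This lets an induction on the
  position peel off leading digits.\<close>

lemma ternary_value_shift:
  assumes "\<And>n. \<alpha> n \<in> {0, 1, 2}"
  shows "3 * \<Delta>\<^sub>3 \<alpha> = of_int (\<alpha> 0) + \<Delta>\<^sub>3 (\<lambda>n. \<alpha> (Suc n))"
proof -
  have "(\<lambda>n. real_of_int (\<alpha> (Suc n)) / 3 ^ Suc (Suc n)) sums (\<Delta>\<^sub>3 \<alpha> - of_int (\<alpha> 0) / 3)"
    using ternary_sums[OF assms] by (subst sums_Suc_iff) simp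
  from sums_mult[OF this, of 3]
  have "(\<lambda>n. real_of_int (\<alpha> (Suc n)) / 3 ^ Suc n) sums (3 * \<Delta>\<^sub>3 \<alpha> - of_int (\<alpha> 0))"
    by (simp add: right_diff_distrib)
  moreover have "(\<lambda>n. real_of_int (\<alpha> (Suc n)) / 3 ^ Suc n) sums \<Delta>\<^sub>3 (\<lambda>n. \<alpha> (Suc n))"
    by (intro ternary_sums assms)
  ultimately show ?thesis
    by (auto dest: sums_unique2)
qed

lemma ternary_leading_digit:
  assumes digits: "\<And>n. \<alpha> n \<in> {0, 1, 2}" and "\<not> (\<exists>N. \<forall>n\<ge>N. \<alpha> n = 2)"
  shows "\<alpha> 0 = \<lfloor>3 * \<Delta>\<^sub>3 \<alpha>\<rfloor>"
proof -
  \<comment> \<open>Position 0 is excluded because the tail after the leading digit must itself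
    contain a digit other than 2.\<close>
  obtain k where "k \<ge> 1" "\<alpha> k \<noteq> 2"
    using assms(2) by blast
  then have "\<alpha> (Suc (k - 1)) \<noteq> 2"
    by simp
  then have "\<Delta>\<^sub>3 (\<lambda>n. \<alpha> (Suc n)) < 1"
    using ternary_value_less_1[of "\<lambda>n. \<alpha> (Suc n)" "k - 1"] digits by blast
  moreover have "0 \<le> \<Delta>\<^sub>3 (\<lambda>n. \<alpha> (Suc n))"
    by (intro ternary_value_nonneg digits)
  ultimately show ?thesis
    unfolding ternary_value_shift[OF digits] by linarith
qed

text \<open>Equal values force equal leading digits, hence equal values of the tails. The tails
  again do not end in 2's, so the induction, with both sequences arbitrary, continues with
  them.\<close>

lemma ternary_value_inject:
  assumes "\<And>n. \<alpha> n \<in> {0, 1, 2}" "\<not> (\<exists>N. \<forall>n\<ge>N. \<alpha> n = 2)"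
    and "\<And>n. \<beta> n \<in> {0, 1, 2}" "\<not> (\<exists>N. \<forall>n\<ge>N. \<beta> n = 2)"
    and "\<Delta>\<^sub>3 \<alpha> = \<Delta>\<^sub>3 \<beta>"
  shows "\<alpha> n = \<beta> n"
  using assms
proof (induction n arbitrary: \<alpha> \<beta>)
  case 0
  then show ?case
    using ternary_leading_digit[of \<alpha>] ternary_leading_digit[of \<beta>] by metis
next
  case (Suc n)
  have "\<alpha> 0 = \<beta> 0"
    using Suc.prems ternary_leading_digit[of \<alpha>] ternary_leading_digit[of \<beta>] by metis
  then have "\<Delta>\<^sub>3 (\<lambda>n. \<alpha> (Suc n)) = \<Delta>\<^sub>3 (\<lambda>n. \<beta> (Suc n))"
    using ternary_value_shift[of \<alpha>] ternary_value_shift[of \<beta>] Suc.prems by simp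
  moreover have "\<not> (\<exists>N. \<forall>n\<ge>N. \<gamma> (Suc n) = 2)" if "\<not> (\<exists>N. \<forall>n\<ge>N. \<gamma> n = 2)" for \<gamma> :: "nat \<Rightarrow> int"
    using that by (metis Suc_le_D Suc_le_mono)
  ultimately show ?case
    using Suc.IH[of "\<lambda>n. \<alpha> (Suc n)" "\<lambda>n. \<beta> (Suc n)"] Suc.prems by blast
qed

text \<open>The factor \<open>3 ^ n\<close> moves the first \<open>n\<close> digits before the
  ternary point and \<open>frac\<close> drops them; one more factor 3 exposes the next digit as a
  floor.\<close>

definition greedy_digit :: "real \<Rightarrow> nat \<Rightarrow> int"
  where "greedy_digit x n = \<lfloor>3 * frac (3 ^ n * x)\<rfloor>"

lemma greedy_digit_range: "greedy_digit x n \<in> {0, 1, 2}"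
proof -
  have "0 \<le> frac (3 ^ n * x)" "frac (3 ^ n * x) < 1"
    by (auto simp: frac_ge_0 frac_lt_1)
  then have "0 \<le> greedy_digit x n" "greedy_digit x n < 3"
    unfolding greedy_digit_def by linarith+
  then show ?thesis
    by auto
qed

lemma greedy_digit_eq_frac:
  "real_of_int (greedy_digit x n) = 3 * frac (3 ^ n * x) - frac (3 ^ Suc n * x)"
proof -
  define y where "y = 3 ^ n * x"
  \<comment> \<open>An integer summand passes through the floor, so the floors of
    \<open>3 * y\<close> and \<open>3 * frac y\<close> differ by exactly this integer.\<close>
  have "3 * y = 3 * frac y + of_int (3 * \<lfloor>y\<rfloor>)"
    by (simp add: frac_def)
  then have "\<lfloor>3 * y\<rfloor> = \<lfloor>3 * frac y\<rfloor> + 3 * \<lfloor>y\<rfloor>"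
    by (metis floor_add_int)
  then have "of_int \<lfloor>3 * frac y\<rfloor> = 3 * frac y - frac (3 * y)"
    by (simp add: frac_def)
  then show ?thesis
    by (simp add: greedy_digit_def y_def mult.assoc)
qed

lemma ternary_value_greedy: "\<Delta>\<^sub>3 (greedy_digit x) = frac x"
proof -
  let ?r = "\<lambda>n. frac (3 ^ n * x) / 3 ^ n"
  have "?r \<longlonglongrightarrow> 0"
  proof (rule tendsto_sandwich[OF _ _ tendsto_const])
    show "\<forall>\<^sub>F n in sequentially. 0 \<le> ?r n"
      by (simp add: frac_ge_0)
    show "\<forall>\<^sub>F n in sequentially. ?r n \<le> (1 / 3) ^ n"
      by (simp add: power_one_over divide_right_mono frac_lt_1 less_imp_le inverse_eq_divide)
    show "(\<lambda>n. (1 / 3) ^ n :: real) \<longlonglongrightarrow> 0"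
      by (intro LIMSEQ_realpow_zero) auto
  qed
  \<comment> \<open>The initial remainder \<open>?r 0\<close> is \<open>frac x\<close>, which
    becomes the value of the series.\<close>
  then have "(\<lambda>n. ?r n - ?r (Suc n)) sums (?r 0 - 0)"
    by (rule telescope_sums')
  moreover have "?r n - ?r (Suc n) = of_int (greedy_digit x n) / 3 ^ Suc n" for n
    by (simp add: greedy_digit_eq_frac diff_divide_distrib)
  ultimately show ?thesis
    unfolding ternary_value_def by (simp add: sums_unique[symmetric])
qed

text \<open>A tail of 2's from \<open>N\<close> on would be the whole greedy expansion of
  \<open>3 ^ N * x\<close>, giving that number the impossible fractional part 1.\<close>

lemma greedy_digit_not_eventually_2: "\<not> (\<exists>N. \<forall>n\<ge>N. greedy_digit x n = 2)"
proof
  assume "\<exists>N. \<forall>n\<ge>N. greedy_digit x n = 2"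
  then obtain N where N: "\<forall>n\<ge>N. greedy_digit x n = 2" ..
  have "greedy_digit (3 ^ N * x) = (\<lambda>_. 2)"
  proof
    fix n
    have "greedy_digit (3 ^ N * x) n = greedy_digit x (n + N)"
      by (simp add: greedy_digit_def power_add mult.assoc)
    then show "greedy_digit (3 ^ N * x) n = 2"
      using N by simp
  qed
  then have "frac (3 ^ N * x) = 1"
    using ternary_value_greedy[of "3 ^ N * x"] ternary_value_const_2 by simp
  then show False
    using frac_lt_1[of "3 ^ N * x"] by simp
qed

lemma admissible_ternary_ex1:
  assumes "x \<in> {0..1}"
  shows "\<exists>!\<alpha>. admissible_ternary x \<alpha>"
proof (cases "x = 1")
  case True
  then show ?thesis
    by (auto simp: admissible_ternary_def ternary_value_const_2)
next
  case False
  \<comment> \<open>Excluding 1 leaves \<open>x < 1\<close>, so the greedy digits have value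
    \<open>x\<close> itself.\<close>
  then have "frac x = x"
    using assms by (simp add: frac_eq)
  then have "admissible_ternary x (greedy_digit x)"
    using False greedy_digit_range greedy_digit_not_eventually_2
    by (simp add: admissible_ternary_def ternary_value_greedy del: insert_iff)
  moreover have "\<alpha> = \<beta>" if "admissible_ternary x \<alpha>" "admissible_ternary x \<beta>" for \<alpha> \<beta>
    using that False unfolding admissible_ternary_def
    by (intro ext ternary_value_inject) auto
  ultimately show ?thesis
    by blast
qed

lemma admissible_ternary_digits:
  "x \<in> {0..1} \<Longrightarrow> admissible_ternary x (ternary_digits x)"
  unfolding ternary_digits_def by (rule theI'[OF admissible_ternary_ex1])

text \<open>Digits are mapped to digits, so the series converges, and linear relations can be
  checked term by term.\<close>

lemma digitwise_sums:
  assumes "x \<in> {0..1}" "\<And>a. a \<in> {0, 1, 2} \<Longrightarrow> \<psi> a \<in> {0, 1, 2}"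
  shows "(\<lambda>n. real_of_int (\<psi> (ternary_digits x n)) / 3 ^ Suc n) sums digitwise \<psi> x"
  unfolding digitwise_def
  using admissible_ternary_digits[OF assms(1)] assms(2)
  by (intro ternary_sums) (simp add: admissible_ternary_def del: insert_iff)

theorem lemma1:
  fixes x :: real
  assumes "x \<in> {0..1}"
  shows "f x = 2 * x - 3 * f01 x \<and>
         f x = 3 / 2 - x - 3 * f12 x \<and>
         f x = x / 2 + 3 / 2 * f02 x"
proof -
  define d where "d = ternary_digits x"
  let ?s = "\<lambda>\<psi> n. real_of_int (\<psi> (d n)) / 3 ^ Suc n"
  have digits: "d n = 0 \<or> d n = 1 \<or> d n = 2" for n
    using admissible_ternary_digits[OF assms] by (simp add: admissible_ternary_def d_def)
  \<comment> \<open>Here the chosen digits are known to represent \<open>x\<close>; the identity map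
    on digits puts \<open>x\<close> in the same form as the four functions.\<close>
  have x: "?s (\<lambda>a. a) sums x"
    using admissible_ternary_digits[OF assms] ternary_sums[of d]
    by (simp add: admissible_ternary_def d_def)
  have f: "?s \<phi> sums f x" and f01: "?s \<phi>01 sums f01 x"
    and f12: "?s \<phi>12 sums f12 x" and f02: "?s \<phi>02 sums f02 x"
    unfolding f_def f01_def f12_def f02_def d_def by (rule digitwise_sums[OF assms]; auto)+
  have "?s \<phi> n = 2 * ?s (\<lambda>a. a) n - 3 * ?s \<phi>01 n" for n
    using digits[of n] by auto
  then have "?s \<phi> sums (2 * x - 3 * f01 x)"
    using sums_diff[OF sums_mult[OF x, of 2] sums_mult[OF f01, of 3]] by simp
  moreover have "?s \<phi> n = 3 * (1 / 3 ^ Suc n) - ?s (\<lambda>a. a) n - 3 * ?s \<phi>12 n" for n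
    using digits[of n] by (auto simp: field_simps)
  then have "?s \<phi> sums (3 * (1 / 2) - x - 3 * f12 x)"
    using sums_diff[OF sums_diff[OF sums_mult[OF ternary_one_sums, of 3] x] sums_mult[OF f12, of 3]]
    by simp
  moreover have "?s \<phi> n = 1 / 2 * ?s (\<lambda>a. a) n + 3 / 2 * ?s \<phi>02 n" for n
    using digits[of n] by (auto simp: field_simps)
  then have "?s \<phi> sums (1 / 2 * x + 3 / 2 * f02 x)"
    using sums_add[OF sums_mult[OF x, of "1 / 2"] sums_mult[OF f02, of "3 / 2"]] by simp
  \<comment> \<open>The single series \<open>?s \<phi>\<close> has been summed in several ways, and
    its limit is unique.\<close>
  ultimately have "f x = 2 * x - 3 * f01 x" "f x = 3 * (1 / 2) - x - 3 * f12 x"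
    "f x = 1 / 2 * x + 3 / 2 * f02 x"
    by (blast intro: sums_unique2[OF f])+
  then show ?thesis
    by simp
qed

end
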